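(* Let $\mathbf{A}$ be a $\top$-cancellative monoid with zero $\top$, and let $\mathbf{B}$ be a semigroup with zero $\bot$, disjoint from $A$, whose multiplication is one of the following four: (i) $B=\{\bot\}$; (ii) $B=\{\bot,b\}$ with $b^2=b$; (iii) $B=\{\bot,b\}$ with $b^2=\bot$; (iv) $B=\{\bot,b_1,b_2\}$ with $b_1^2=b_1$, $b_2^2=b_2$, $b_1b_2=b_2b_1=\bot$. Then the algebra $\mathbf{R}_{\mathbf{A},\mathbf{B}}$ is the reduct of a residuated lattice based on $\mathbf{M}_X$, where $X=(A\cup B)\setminus\{\bot,\top\}$.
   Context: A residuated lattice is an algebra $(R,\wedge,\vee,\cdot,\backslash,/,1)$ such that $(R,\wedge,\vee)$ is a lattice, $(R,\cdot,1)$ is a monoid, and for all $x,y,z\in R$: $xy\le z \iff y\le x\backslash z \iff x\le z/y$. For a set $X$, $\mathbf{M}_X$ is the lattice on $X\cup\{\bot,\top\}$ ($\bot\neq\top$, neither in $X$) with top $\top$, bottom $\bot$, and $x\vee y=\top$, $x\wedge y=\bot$ for distinct $x,y\in X$. A residuated lattice is "based on $\mathbf{M}_X$" if $\mathbf{M}_X$ is its lattice reduct. A monoid with zero (absorbing element) $\top$ is $\top$-cancellative if for all $x,y,z$: $xy=xz\neq\top$ implies $y=z$, and $yx=zx\neq\top$ implies $y=z$. In each of the four semigroups $\mathbf{B}$, $\bot$ is absorbing. The algebra $\mathbf{R}_{\mathbf{A},\mathbf{B}}$ has underlying set $R=A\cup B$, the lattice structure $\mathbf{M}_X$ with $X=R\setminus\{\bot,\top\}$,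 bottom $\bot$ and top $\top$, the multiplication that extends those of $\mathbf{A}$ and $\mathbf{B}$ by $xy=yx=y$ for all $x\in A$, $y\in B$, and the identity element of $\mathbf{A}$ as its constant $1$. *)

theory Defs
  imports "HOL-Algebra.Lattice" "HOL-Algebra.Group"
begin

section \<open>Residuated lattices\<close>

text \<open>
  Lattices are those of HOL-Algebra, i.e. given by their order; meet and join are derived from it.
  A lattice with a multiplication and a constant 1 is one record, and its extension by the two
  divisions has the signature of residuated lattices; forgetting the divisions is
  \<open>lat_monoid.truncate\<close>, forgetting everything but the lattice is \<open>gorder.truncate\<close>.
\<close>

record 'a lat_monoid = "'a gorder" +
  lmult :: "['a, 'a] \<Rightarrow> 'a" (infixl \<open>\<odot>\<index>\<close> 70)
  lone  :: 'a

record 'a res_lattice = "'a lat_monoid" +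
  ldiv :: "['a, 'a] \<Rightarrow> 'a"  \<comment> \<open>\<open>ldiv R x z\<close> is \<open>x\<close> under \<open>z\<close>\<close>
  rdiv :: "['a, 'a] \<Rightarrow> 'a"  \<comment> \<open>\<open>rdiv R z y\<close> is \<open>z\<close> over \<open>y\<close>\<close>

definition monoid_reduct :: "('a, 'm) lat_monoid_scheme \<Rightarrow> 'a monoid" where
  "monoid_reduct R = \<lparr>carrier = carrier R, mult = lmult R, one = lone R\<rparr>"

locale residuated_lattice = lattice R + mon: monoid "monoid_reduct R"
  for R :: "('a, 'm) res_lattice_scheme" (structure) +
  assumes ldiv_closed: "\<lbrakk>x \<in> carrier R; z \<in> carrier R\<rbrakk> \<Longrightarrow> ldiv R x z \<in> carrier R"
    and rdiv_closed: "\<lbrakk>z \<in> carrier R; y \<in> carrier R\<rbrakk> \<Longrightarrow> rdiv R z y \<in> carrier R"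
    and ldiv_residual: "\<lbrakk>x \<in> carrier R; y \<in> carrier R; z \<in> carrier R\<rbrakk> \<Longrightarrow>
      x \<odot> y \<sqsubseteq> z \<longleftrightarrow> y \<sqsubseteq> ldiv R x z"
    and rdiv_residual: "\<lbrakk>x \<in> carrier R; y \<in> carrier R; z \<in> carrier R\<rbrakk> \<Longrightarrow>
      x \<odot> y \<sqsubseteq> z \<longleftrightarrow> x \<sqsubseteq> rdiv R z y"


section \<open>The lattice on a set with bottom and top adjoined\<close>

text \<open>Meaningful for distinct \<open>bt\<close>, \<open>tp\<close> outside \<open>X\<close>; see the lemmas below for its operations.\<close>

definition M_lattice :: "'a set \<Rightarrow> 'a \<Rightarrow> 'a \<Rightarrow> 'a gorder" where
  "M_lattice X bt tp =
     \<lparr>carrier = X \<union> {bt, tp}, eq = (=), le = (\<lambda>x y. x = y \<or> x = bt \<or> y = tp)\<rparr>"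

lemma M_lattice_partial_order:
  assumes "bt \<noteq> tp" "bt \<notin> X" "tp \<notin> X"
  shows "partial_order (M_lattice X bt tp)"
  using assms by unfold_locales (auto simp: M_lattice_def)

lemma M_lattice_bounds:
  assumes "x \<in> carrier (M_lattice X bt tp)"
  shows "le (M_lattice X bt tp) bt x" "le (M_lattice X bt tp) x tp"
  using assms by (auto simp: M_lattice_def)

lemma M_lattice_least_Upper:
  assumes "bt \<noteq> tp" "bt \<notin> X" "tp \<notin> X" "x \<in> X" "y \<in> X" "x \<noteq> y"
  shows "least (M_lattice X bt tp) tp (Upper (M_lattice X bt tp) {x, y})"
  using assms by (auto simp: least_def Upper_def M_lattice_def)

lemma M_lattice_greatest_Lower:
  assumes "bt \<noteq> tp" "bt \<notin> X" "tp \<notin> X" "x \<in> X" "y \<in> X" "x \<noteq> y"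
  shows "greatest (M_lattice X bt tp) bt (Lower (M_lattice X bt tp) {x, y})"
  using assms by (auto simp: greatest_def Lower_def M_lattice_def)

lemma M_lattice_lattice:
  assumes "bt \<noteq> tp" "bt \<notin> X" "tp \<notin> X"
  shows "lattice (M_lattice X bt tp)"
proof -
  let ?L = "M_lattice X bt tp"
  interpret partial_order ?L by (rule M_lattice_partial_order[OF assms])
  have cmp: "\<exists>s. least ?L s (Upper ?L {x, y})" "\<exists>s. greatest ?L s (Lower ?L {x, y})"
    if "x \<in> carrier ?L" "y \<in> carrier ?L" "le ?L x y" for x y
  proof -
    from that have "least ?L y (Upper ?L {x, y})"
      by (auto simp: least_def Upper_def M_lattice_def)
    then show "\<exists>s. least ?L s (Upper ?L {x, y})" ..
    from that have "greatest ?L x (Lower ?L {x, y})"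
      by (auto simp: greatest_def Lower_def M_lattice_def)
    then show "\<exists>s. greatest ?L s (Lower ?L {x, y})" ..
  qed
  have cases: "le ?L x y \<or> le ?L y x \<or> (x \<in> X \<and> y \<in> X \<and> x \<noteq> y)"
    if "x \<in> carrier ?L" "y \<in> carrier ?L" for x y
    using that by (auto simp: M_lattice_def)
  show ?thesis
  proof unfold_locales
    fix x y assume xy: "x \<in> carrier ?L" "y \<in> carrier ?L"
    show "\<exists>s. least ?L s (Upper ?L {x, y})"
      using cases[OF xy] cmp(1)[OF xy] cmp(1)[OF xy(2) xy(1)] M_lattice_least_Upper[OF assms, of x y]
      by (metis insert_commute)
    show "\<exists>s. greatest ?L s (Lower ?L {x, y})"
      using cases[OF xy] cmp(2)[OF xy] cmp(2)[OF xy(2) xy(1)] M_lattice_greatest_Lower[OF assms, of x y]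
      by (metis insert_commute)
  qed
qed

lemma M_lattice_join_meet:
  assumes "bt \<noteq> tp" "bt \<notin> X" "tp \<notin> X" "x \<in> X" "y \<in> X" "x \<noteq> y"
  shows "x \<squnion>\<^bsub>M_lattice X bt tp\<^esub> y = tp" "x \<sqinter>\<^bsub>M_lattice X bt tp\<^esub> y = bt"
proof -
  let ?L = "M_lattice X bt tp"
  interpret lattice ?L by (rule M_lattice_lattice[OF assms(1-3)])
  show "x \<squnion>\<^bsub>?L\<^esub> y = tp"
    unfolding join_def sup_def
    using M_lattice_least_Upper[OF assms] least_unique by (metis someI_ex)
  show "x \<sqinter>\<^bsub>?L\<^esub> y = bt"
    unfolding meet_def inf_def
    using M_lattice_greatest_Lower[OF assms] greatest_unique by (metis someI_ex)
qed


section \<open>The two components\<close>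

locale monoid_with_zero = monoid A for A (structure) +
  fixes zr
  assumes zr_closed: "zr \<in> carrier A"
    and zr_left: "x \<in> carrier A \<Longrightarrow> zr \<otimes> x = zr"
    and zr_right: "x \<in> carrier A \<Longrightarrow> x \<otimes> zr = zr"

locale zero_cancellative_monoid = monoid_with_zero A zr for A (structure) and zr +
  assumes left_cancel:
      "\<lbrakk>x \<in> carrier A; y \<in> carrier A; z \<in> carrier A; x \<otimes> y = x \<otimes> z; x \<otimes> z \<noteq> zr\<rbrakk> \<Longrightarrow> y = z"
    and right_cancel:
      "\<lbrakk>x \<in> carrier A; y \<in> carrier A; z \<in> carrier A; y \<otimes> x = z \<otimes> x; z \<otimes> x \<noteq> zr\<rbrakk> \<Longrightarrow> y = z"

record 'a sgrp = "'a partial_object" +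
  smult :: "['a, 'a] \<Rightarrow> 'a" (infixl \<open>\<bullet>\<index>\<close> 70)

locale semigroup_with_zero =
  fixes B (structure) and zr
  assumes s_closed: "\<lbrakk>x \<in> carrier B; y \<in> carrier B\<rbrakk> \<Longrightarrow> x \<bullet> y \<in> carrier B"
    and s_assoc: "\<lbrakk>x \<in> carrier B; y \<in> carrier B; z \<in> carrier B\<rbrakk> \<Longrightarrow>
      (x \<bullet> y) \<bullet> z = x \<bullet> (y \<bullet> z)"
    and zr_closed: "zr \<in> carrier B"
    and zr_left: "x \<in> carrier B \<Longrightarrow> zr \<bullet> x = zr"
    and zr_right: "x \<in> carrier B \<Longrightarrow> x \<bullet> zr = zr"

text \<open>The products involving \<open>bt\<close> are not listed: \<open>bt\<close> is the zero of \<open>B\<close>.\<close>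

definition four_semigroups :: "('a, 'm) sgrp_scheme \<Rightarrow> 'a \<Rightarrow> bool" where
  "four_semigroups B bt \<longleftrightarrow>
     carrier B = {bt} \<or>
     (\<exists>b. b \<noteq> bt \<and> carrier B = {bt, b} \<and> b \<bullet>\<^bsub>B\<^esub> b = b) \<or>
     (\<exists>b. b \<noteq> bt \<and> carrier B = {bt, b} \<and> b \<bullet>\<^bsub>B\<^esub> b = bt) \<or>
     (\<exists>b1 b2. b1 \<noteq> bt \<and> b2 \<noteq> bt \<and> b1 \<noteq> b2 \<and> carrier B = {bt, b1, b2} \<and>
        b1 \<bullet>\<^bsub>B\<^esub> b1 = b1 \<and> b2 \<bullet>\<^bsub>B\<^esub> b2 = b2 \<and> b1 \<bullet>\<^bsub>B\<^esub> b2 = bt \<and> b2 \<bullet>\<^bsub>B\<^esub> b1 = bt)"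


section \<open>The algebra built from the two components\<close>

definition R_mult ::
  "('a, 'm) monoid_scheme \<Rightarrow> ('a, 'n) sgrp_scheme \<Rightarrow> 'a \<Rightarrow> 'a \<Rightarrow> 'a" where
  "R_mult A B x y =
     (if x \<in> carrier A \<and> y \<in> carrier A then x \<otimes>\<^bsub>A\<^esub> y
      else if x \<in> carrier B \<and> y \<in> carrier B then x \<bullet>\<^bsub>B\<^esub> y
      else if x \<in> carrier A \<and> y \<in> carrier B then y
      else if x \<in> carrier B \<and> y \<in> carrier A then x
      else undefined)"

definition R_algebra ::
  "('a, 'm) monoid_scheme \<Rightarrow> 'a \<Rightarrow> ('a, 'n) sgrp_scheme \<Rightarrow> 'a \<Rightarrow> 'a lat_monoid" where
  "R_algebra A tp B bt =
     \<lparr>carrier = carrier A \<union> carrier B,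
      eq = (=),
      le = le (M_lattice ((carrier A \<union> carrier B) - {bt, tp}) bt tp),
      lmult = R_mult A B,
      lone = \<one>\<^bsub>A\<^esub>\<rparr>"

end

theory Submission
  imports Defs
begin

text \<open>
  In \<open>M\<^sub>X\<close> the principal down-sets are the whole set, the singleton of the bottom, and the
  two-element sets consisting of the bottom and one atom. A multiplication with identity thus
  extends to a residuated lattice once it is associative and each set
  \<open>{y. x y \<le> z}\<close>, and likewise each \<open>{y. y x \<le> z}\<close>, has one of these three shapes.

  For \<open>z\<close> the top the set is everything.
  For \<open>x \<in> A\<close> and an atom \<open>z \<in> A\<close> the set consists of the bottom and the solutions of \<open>x y = z\<close>;
  as \<open>z\<close> is not the zero of \<open>A\<close>, cancellation leaves at most one solution.
  For \<open>x \<in> A\<close> and \<open>z \<in> B\<close> it is the down-set of \<open>z\<close>, because \<open>x\<close> acts as an identity on \<open>B\<close>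
  and products in \<open>A\<close> never fall below \<open>z\<close>.
  For \<open>x \<in> B\<close> two features shared by the four semigroups suffice: every product \<open>x y\<close> in \<open>B\<close>
  is \<open>x\<close> or the bottom (\<open>B_mult_absorb\<close>), and the annihilator of a nonzero \<open>x\<close> contains at
  most one nonzero element (\<open>B_annihilator\<close>). The first gives the whole set when \<open>x \<le> z\<close>, and when
  \<open>x \<not>\<le> z\<close> it reduces the set to the annihilator of \<open>x\<close>, which the second makes principal.

  The hypotheses are invariant under reversing both multiplications, so right residuals
  come from left residuals of the opposite components.
\<close>

section \<open>The product on the union of the components\<close>

locale components = A: zero_cancellative_monoid A tp + B: semigroup_with_zero B bt
  for A :: "('a, 'm) monoid_scheme" and tp :: 'a
    and B :: "('a, 'n) sgrp_scheme" and bt :: 'a +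
  assumes disjoint: "carrier A \<inter> carrier B = {}"
    and four: "four_semigroups B bt"
begin

abbreviation R where "R \<equiv> carrier A \<union> carrier B"

abbreviation R_le (infix \<open>\<preceq>\<close> 50) where
  "x \<preceq> y \<equiv> le (M_lattice (R - {bt, tp}) bt tp) x y"

lemma R_le_iff: "x \<preceq> y \<longleftrightarrow> x = y \<or> x = bt \<or> y = tp"
  by (simp add: M_lattice_def)

lemma not_in_both: "x \<in> carrier A \<Longrightarrow> x \<notin> carrier B"
  using disjoint by blast

lemma bt_neq_tp: "bt \<noteq> tp"
  using not_in_both A.zr_closed B.zr_closed by blast

lemma R_mult_simps [simp]:
  "x \<in> carrier A \<Longrightarrow> y \<in> carrier A \<Longrightarrow> R_mult A B x y = x \<otimes>\<^bsub>A\<^esub> y"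
  "x \<in> carrier B \<Longrightarrow> y \<in> carrier B \<Longrightarrow> R_mult A B x y = x \<bullet>\<^bsub>B\<^esub> y"
  "x \<in> carrier A \<Longrightarrow> y \<in> carrier B \<Longrightarrow> R_mult A B x y = y"
  "x \<in> carrier B \<Longrightarrow> y \<in> carrier A \<Longrightarrow> R_mult A B x y = x"
  using not_in_both by (auto simp: R_mult_def)

lemma R_mult_closed: "x \<in> R \<Longrightarrow> y \<in> R \<Longrightarrow> R_mult A B x y \<in> R"
  by (auto simp: B.s_closed)

lemma R_mult_assoc:
  assumes "x \<in> R" "y \<in> R" "z \<in> R"
  shows "R_mult A B (R_mult A B x y) z = R_mult A B x (R_mult A B y z)"
  using assms by (auto simp: A.m_assoc B.s_assoc B.s_closed)

lemma R_mult_one: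
  assumes "x \<in> R"
  shows "R_mult A B \<one>\<^bsub>A\<^esub> x = x" "R_mult A B x \<one>\<^bsub>A\<^esub> = x"
  using assms by auto

section \<open>Residuals\<close>

lemma B_mult_absorb:
  assumes "x \<in> carrier B" "y \<in> carrier B"
  shows "x \<bullet>\<^bsub>B\<^esub> y = x \<or> x \<bullet>\<^bsub>B\<^esub> y = bt"
  using four assms B.zr_left B.zr_right unfolding four_semigroups_def by fastforce

text \<open>
  The witness is the bottom when \<open>x\<close> is the only nonzero idempotent, \<open>x\<close> itself when its square
  is zero, and the other nonzero idempotent when there are two.
\<close>

lemma B_annihilator:
  assumes "x \<in> carrier B" "x \<noteq> bt"
  obtains c where "c \<in> carrier B"
    and "\<And>y. y \<in> carrier B \<Longrightarrow> x \<bullet>\<^bsub>B\<^esub> y = bt \<longleftrightarrow> y = bt \<or> y = c"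
proof -
  have "\<exists>c \<in> carrier B. \<forall>y \<in> carrier B. x \<bullet>\<^bsub>B\<^esub> y = bt \<longleftrightarrow> y = bt \<or> y = c"
    using four unfolding four_semigroups_def
  proof (elim disjE exE conjE)
    assume "carrier B = {bt}"
    then show ?thesis using assms by simp
  next
    fix b assume "carrier B = {bt, b}" "b \<noteq> bt" "b \<bullet>\<^bsub>B\<^esub> b = b"
    then show ?thesis using assms B.zr_right[of b] by (intro bexI[of _ bt]) auto
  next
    fix b assume "carrier B = {bt, b}" "b \<noteq> bt" "b \<bullet>\<^bsub>B\<^esub> b = bt"
    then show ?thesis using assms B.zr_right[of b] by (intro bexI[of _ b]) auto
  next
    fix b1 b2
    assume B: "carrier B = {bt, b1, b2}" "b1 \<noteq> bt" "b2 \<noteq> bt" "b1 \<noteq> b2"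
      "b1 \<bullet>\<^bsub>B\<^esub> b1 = b1" "b2 \<bullet>\<^bsub>B\<^esub> b2 = b2" "b1 \<bullet>\<^bsub>B\<^esub> b2 = bt" "b2 \<bullet>\<^bsub>B\<^esub> b1 = bt"
    then have "x = b1 \<or> x = b2" using assms by simp
    then show ?thesis
    proof
      assume "x = b1"
      then show ?thesis using B B.zr_right[of b1] by (intro bexI[of _ b2]) auto
    next
      assume "x = b2"
      then show ?thesis using B B.zr_right[of b2] by (intro bexI[of _ b1]) auto
    qed
  qed
  then show ?thesis using that by blast
qed

lemma left_residual_A:
  assumes x: "x \<in> carrier A" and z: "z \<in> R"
  shows "\<exists>w \<in> R. \<forall>y \<in> R. R_mult A B x y \<preceq> z \<longleftrightarrow> y \<preceq> w"
proof -
  have A_not_bt: "bt \<notin> carrier A"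
    using not_in_both B.zr_closed by blast
  consider (top) "z = tp" | (B) "z \<in> carrier B" | (A) "z \<in> carrier A" "z \<noteq> tp"
    using z by blast
  then show ?thesis
  proof cases
    case top
    then show ?thesis by (intro bexI[of _ tp]) (auto simp: R_le_iff A.zr_closed)
  next
    case B
    then have "z \<noteq> tp" using not_in_both A.zr_closed by blast
    then have "\<forall>y \<in> R. R_mult A B x y \<preceq> z \<longleftrightarrow> y \<preceq> z"
      using x B not_in_both A_not_bt A.m_closed[OF x] by (auto simp: R_le_iff)
    then show ?thesis using B by blast
  next
    case A
    have le_iff: "R_mult A B x y \<preceq> z \<longleftrightarrow> y = bt \<or> (y \<in> carrier A \<and> x \<otimes>\<^bsub>A\<^esub> y = z)"
      if "y \<in> R" for y
      using that x A not_in_both A_not_bt B.zr_closed by (auto simp: R_le_iff)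
    show ?thesis
    proof (cases "\<exists>w \<in> carrier A. x \<otimes>\<^bsub>A\<^esub> w = z")
      case True
      then obtain w where w: "w \<in> carrier A" "x \<otimes>\<^bsub>A\<^esub> w = z" by blast
      \<comment> \<open>A solution is an atom, since the zero of \<open>A\<close> only yields the zero.\<close>
      have "w \<noteq> tp" using w x A A.zr_right by blast
      have "y = w" if "y \<in> carrier A" "x \<otimes>\<^bsub>A\<^esub> y = z" for y
        using A.left_cancel[of x y w] that w x A by simp
      then have "y = bt \<or> (y \<in> carrier A \<and> x \<otimes>\<^bsub>A\<^esub> y = z) \<longleftrightarrow> y \<preceq> w" for y
        unfolding R_le_iff using w \<open>w \<noteq> tp\<close> by blast
      then have "\<forall>y \<in> R. R_mult A B x y \<preceq> z \<longleftrightarrow> y \<preceq> w"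
        using le_iff by blast
      then show ?thesis using w by blast
    next
      case False
      then have "y = bt \<or> (y \<in> carrier A \<and> x \<otimes>\<^bsub>A\<^esub> y = z) \<longleftrightarrow> y \<preceq> bt" for y
        unfolding R_le_iff using bt_neq_tp by blast
      then have "\<forall>y \<in> R. R_mult A B x y \<preceq> z \<longleftrightarrow> y \<preceq> bt"
        using le_iff by blast
      then show ?thesis using B.zr_closed by blast
    qed
  qed
qed

lemma left_residual_B:
  assumes x: "x \<in> carrier B"
  shows "\<exists>w \<in> R. \<forall>y \<in> R. R_mult A B x y \<preceq> z \<longleftrightarrow> y \<preceq> w"
proof (cases "x \<preceq> z")
  case True
  have "R_mult A B x y \<preceq> z" if "y \<in> R" for y
    using that x True B_mult_absorb[of x y] by (auto simp: R_le_iff)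
  then show ?thesis
    using A.zr_closed by (intro bexI[of _ tp]) (auto simp: R_le_iff)
next
  case False
  then have "x \<noteq> bt" by (simp add: R_le_iff)
  then obtain c where c: "c \<in> carrier B"
    and ann: "\<And>y. y \<in> carrier B \<Longrightarrow> x \<bullet>\<^bsub>B\<^esub> y = bt \<longleftrightarrow> y = bt \<or> y = c"
    using B_annihilator x by blast
  have "c \<noteq> tp" using c not_in_both A.zr_closed by blast
  have "R_mult A B x y \<preceq> z \<longleftrightarrow> y \<preceq> c" if y: "y \<in> R" for y
  proof (cases "y \<in> carrier A")
    case True
    then have "\<not> y \<preceq> c"
      using c \<open>c \<noteq> tp\<close> not_in_both B.zr_closed by (auto simp: R_le_iff)
    then show ?thesis using True x False by simp
  next
    case yB: False
    then have "y \<in> carrier B" using y by blast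
    moreover from this have "x \<bullet>\<^bsub>B\<^esub> y \<preceq> z \<longleftrightarrow> x \<bullet>\<^bsub>B\<^esub> y = bt"
      using B_mult_absorb[OF x, of y] False by (auto simp: R_le_iff)
    ultimately show ?thesis
      using x ann \<open>c \<noteq> tp\<close> by (auto simp: R_le_iff)
  qed
  then show ?thesis using c by blast
qed

lemma left_residual:
  assumes "x \<in> R" "z \<in> R"
  shows "\<exists>w \<in> R. \<forall>y \<in> R. R_mult A B x y \<preceq> z \<longleftrightarrow> y \<preceq> w"
  using assms(1) left_residual_A[OF _ assms(2)] left_residual_B by (rule UnE)

end

definition opposite_monoid :: "('a, 'm) monoid_scheme \<Rightarrow> 'a monoid" where
  "opposite_monoid A = \<lparr>carrier = carrier A, mult = (\<lambda>x y. y \<otimes>\<^bsub>A\<^esub> x), one = \<one>\<^bsub>A\<^esub>\<rparr>"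

definition opposite_sgrp :: "('a, 'n) sgrp_scheme \<Rightarrow> 'a sgrp" where
  "opposite_sgrp B = \<lparr>carrier = carrier B, smult = (\<lambda>x y. y \<bullet>\<^bsub>B\<^esub> x)\<rparr>"

lemma opposite_zero_cancellative_monoid:
  assumes "zero_cancellative_monoid A tp"
  shows "zero_cancellative_monoid (opposite_monoid A) tp"
proof -
  interpret zero_cancellative_monoid A tp by fact
  show ?thesis
  proof unfold_locales
    fix x y z
    assume "x \<in> carrier (opposite_monoid A)" "y \<in> carrier (opposite_monoid A)"
      "z \<in> carrier (opposite_monoid A)"
    then have xyz: "x \<in> carrier A" "y \<in> carrier A" "z \<in> carrier A"
      by (simp_all add: opposite_monoid_def)
    show "y = z"
      if "x \<otimes>\<^bsub>opposite_monoid A\<^esub> y = x \<otimes>\<^bsub>opposite_monoid A\<^esub> z"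
        "x \<otimes>\<^bsub>opposite_monoid A\<^esub> z \<noteq> tp"
      using right_cancel[OF xyz] that by (simp add: opposite_monoid_def)
    show "y = z"
      if "y \<otimes>\<^bsub>opposite_monoid A\<^esub> x = z \<otimes>\<^bsub>opposite_monoid A\<^esub> x"
        "z \<otimes>\<^bsub>opposite_monoid A\<^esub> x \<noteq> tp"
      using left_cancel[OF xyz] that by (simp add: opposite_monoid_def)
  qed (auto simp: opposite_monoid_def m_assoc zr_closed zr_left zr_right)
qed

lemma opposite_semigroup_with_zero:
  assumes "semigroup_with_zero B bt"
  shows "semigroup_with_zero (opposite_sgrp B) bt"
proof -
  interpret semigroup_with_zero B bt by fact
  show ?thesis
    by unfold_locales
      (auto simp: opposite_sgrp_def s_closed s_assoc zr_closed zr_left zr_right)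
qed

lemma opposite_four_semigroups:
  "four_semigroups B bt \<Longrightarrow> four_semigroups (opposite_sgrp B) bt"
  unfolding four_semigroups_def opposite_sgrp_def
  by (simp only: sgrp.simps partial_object.simps conj_ac)

lemma (in components) opposite_components:
  "components (opposite_monoid A) tp (opposite_sgrp B) bt"
  using opposite_zero_cancellative_monoid[OF A.zero_cancellative_monoid_axioms]
    opposite_semigroup_with_zero[OF B.semigroup_with_zero_axioms]
    opposite_four_semigroups[OF four] disjoint
  by (simp add: components_def components_axioms_def opposite_monoid_def opposite_sgrp_def)

lemma (in components) right_residual:
  assumes "y \<in> R" "z \<in> R"
  shows "\<exists>w \<in> R. \<forall>x \<in> R. R_mult A B x y \<preceq> z \<longleftrightarrow> x \<preceq> w"
proof -
  interpret op: components "opposite_monoid A" tp "opposite_sgrp B" bt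
    by (rule opposite_components)
  have carriers: "carrier (opposite_monoid A) = carrier A" "carrier (opposite_sgrp B) = carrier B"
    by (simp_all add: opposite_monoid_def opposite_sgrp_def)
  have "R_mult (opposite_monoid A) (opposite_sgrp B) y x = R_mult A B x y" if "x \<in> R" for x
    using that assms(1)
    by (elim UnE) (simp_all add: carriers, simp_all add: opposite_monoid_def opposite_sgrp_def)
  then show ?thesis
    using op.left_residual[of y z] assms by (simp add: carriers)
qed

section \<open>The residuated lattice\<close>

lemma lattice_truncate_iff: "lattice (gorder.truncate L) \<longleftrightarrow> lattice L"
proof -
  have fields: "carrier (gorder.truncate L) = carrier L" "eq (gorder.truncate L) = eq L"
    "le (gorder.truncate L) = le L"
    by (simp_all add: gorder.defs)
  have bounds: "Upper (gorder.truncate L) = Upper L" "Lower (gorder.truncate L) = Lower L"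
    by (simp_all add: Upper_def Lower_def fields fun_eq_iff)
  have "least (gorder.truncate L) = least L" "greatest (gorder.truncate L) = greatest L"
    by (simp_all add: least_def greatest_def fields fun_eq_iff)
  note preserved = fields bounds this
  show ?thesis
    by (simp only: lattice_def upper_semilattice_def lower_semilattice_def
        upper_semilattice_axioms_def lower_semilattice_axioms_def
        partial_order_def partial_order_axioms_def weak_partial_order_def
        weak_partial_order_axioms_def equivalence_def preserved)
qed

theorem theorem2p2:
  fixes A :: "('a, 'm) monoid_scheme" and tp :: 'a
    and B :: "('a, 'n) sgrp_scheme" and bt :: 'a
  assumes "zero_cancellative_monoid A tp"
    and "semigroup_with_zero B bt"
    and "carrier A \<inter> carrier B = {}"
    and "four_semigroups B bt"
  shows "\<exists>S :: 'a res_lattice.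
    residuated_lattice S \<and>
    lat_monoid.truncate S = R_algebra A tp B bt \<and>
    gorder.truncate S = M_lattice ((carrier A \<union> carrier B) - {bt, tp}) bt tp"
proof -
  interpret components A tp B bt
    using assms by (simp add: components_def components_axioms_def)
  let ?M = "M_lattice (R - {bt, tp}) bt tp"
  obtain ld where ld: "\<And>x z. x \<in> R \<Longrightarrow> z \<in> R \<Longrightarrow>
      ld x z \<in> R \<and> (\<forall>y \<in> R. R_mult A B x y \<preceq> z \<longleftrightarrow> y \<preceq> ld x z)"
    using left_residual by metis
  obtain rd where rd: "\<And>y z. y \<in> R \<Longrightarrow> z \<in> R \<Longrightarrow>
      rd y z \<in> R \<and> (\<forall>x \<in> R. R_mult A B x y \<preceq> z \<longleftrightarrow> x \<preceq> rd y z)"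
    using right_residual by metis
  define S :: "'a res_lattice" where
    "S = \<lparr>carrier = R, eq = (=), le = (\<preceq>), lmult = R_mult A B, lone = \<one>\<^bsub>A\<^esub>,
      ldiv = ld, rdiv = (\<lambda>z y. rd y z)\<rparr>"
  have reduct: "lat_monoid.truncate S = R_algebra A tp B bt"
    by (simp add: S_def lat_monoid.defs R_algebra_def)
  have base: "gorder.truncate S = ?M"
    using A.zr_closed B.zr_closed by (auto simp: S_def gorder.defs M_lattice_def)
  have "lattice ?M"
    by (rule M_lattice_lattice) (simp_all add: bt_neq_tp)
  then have "lattice S"
    using lattice_truncate_iff base by metis
  moreover have "monoid (monoid_reduct S)"
    using R_mult_closed R_mult_assoc R_mult_one
    by unfold_locales (simp_all add: S_def monoid_reduct_def)
  moreover have "residuated_lattice_axioms S"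
    using ld rd by unfold_locales (simp_all add: S_def)
  ultimately have "residuated_lattice S"
    by (simp add: residuated_lattice_def)
  then show ?thesis using reduct base by blast
qed

end
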